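(* Let $p$ be a prime and let $n$ be a non-negative integer with base-$p$ expansion $$n=a_0+a_1p+\cdots+a_kp^k+a_{k+1}p^{k+1}+\cdots+a_lp^l,$$ where $0\le a_i\le p-1$ for all $i$, and let $k$ be a positive integer with $1\le k\le l$. Put $$a_{(k)}=a_k+a_{k+1}p+\cdots+a_lp^{l-k},\qquad b_{(k)}=a_0+a_1p+\cdots+a_{k-1}p^{k-1},$$ so that $n=a_{(k)}p^k+b_{(k)}$ with $0\le b_{(k)}\le p^k-1$. Then $$\binom{a_{(k)}p^k+b_{(k)}}{p^k}-\left\lfloor\frac{a_{(k)}p^k+b_{(k)}}{p^k}\right\rfloor\equiv 0\pmod p.$$
   Context: $\lfloor\cdot\rfloor$ denotes the floor function, and $\binom{m}{j}$ is the usual binomial coefficient, equal to $0$ when $m<j$. *)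

theory Defs
  imports Complex_Main "HOL-Number_Theory.Cong"
begin

end

theory Submission
  imports Defs
begin

text \<open>
  Vandermonde's identity, together with \<open>p dvd (p ^ k choose j)\<close> for \<open>0 < j < p ^ k\<close>, shows that
  raising the upper index by \<open>p ^ k\<close> raises \<open>m choose p ^ k\<close> by \<open>1\<close> modulo \<open>p\<close>. Starting from
  \<open>B choose p ^ k = 0\<close>, after \<open>A\<close> such steps the value is \<open>A\<close>, which is also the floor.
\<close>

text \<open>Absorption gives
  \<open>j * (p ^ k choose j) = p ^ k * ((p ^ k - 1) choose (j - 1))\<close>. Were the coefficient
  prime to \<open>p\<close>, all of \<open>p ^ k\<close> would have to divide \<open>j\<close>,
  which is too small for that.\<close>

lemma prime_dvd_prime_power_choose:
  fixes p k j :: nat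
  assumes "prime p" and "0 < j" and "j < p ^ k"
  shows "p dvd (p ^ k choose j)"
proof (rule ccontr)
  assume "\<not> p dvd (p ^ k choose j)"
  then have "coprime (p ^ k) (p ^ k choose j)"
    using assms(1) by (simp add: prime_imp_coprime)
  moreover have "p ^ k dvd j * (p ^ k choose j)"
    using times_binomial_minus1_eq[OF assms(2), of "p ^ k"] by simp
  ultimately have "p ^ k dvd j"
    by (simp add: coprime_dvd_mult_left_iff)
  then show False
    using assms(2,3) by (auto dest: dvd_imp_le)
qed

lemma choose_prime_power_add_cong:
  fixes p k m :: nat
  assumes "prime p"
  shows "[(m + p ^ k) choose (p ^ k) = (m choose (p ^ k)) + 1] (mod p)"
proof -
  define q where "q = p ^ k"
  define f where "f j = (q choose j) * (m choose (q - j))" for j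
  have "0 < q"
    using assms by (simp add: q_def prime_gt_0_nat)
  have "(m + q) choose q = (\<Sum>j\<le>q. f j)"
    using vandermonde[of q m q] by (simp add: f_def add.commute)
  \<comment> \<open>The two end terms survive modulo \<open>p\<close>: \<open>j = 0\<close>
    contributes \<open>m choose q\<close> and \<open>j = q\<close> contributes 1. They are distinct
    indices because \<open>q\<close> is positive.\<close>
  also have "{..q} = insert 0 (insert q {0<..<q})"
    using \<open>0 < q\<close> by auto
  also have "sum f \<dots> = (m choose q) + 1 + (\<Sum>j\<in>{0<..<q}. f j)"
    using \<open>0 < q\<close> by (simp add: f_def)
  finally have "(m + q) choose q = (m choose q) + 1 + (\<Sum>j\<in>{0<..<q}. f j)" .
  moreover have "p dvd (\<Sum>j\<in>{0<..<q}. f j)"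
    using assms by (auto simp: f_def q_def intro!: dvd_sum dvd_mult2 prime_dvd_prime_power_choose)
  ultimately show ?thesis
    unfolding q_def[symmetric] by (auto simp: cong_def elim!: dvdE)
qed

lemma choose_prime_power_cong:
  fixes p k A B :: nat
  assumes "prime p" and "B < p ^ k"
  shows "[(A * p ^ k + B) choose (p ^ k) = A] (mod p)"
proof (induction A)
  case 0
  then show ?case
    using assms(2) by (simp add: binomial_eq_0)
next
  case (Suc A)
  have "[((A * p ^ k + B) + p ^ k) choose (p ^ k) = ((A * p ^ k + B) choose (p ^ k)) + 1] (mod p)"
    by (rule choose_prime_power_add_cong[OF assms(1)])
  also have "[((A * p ^ k + B) choose (p ^ k)) + 1 = A + 1] (mod p)"
    by (intro cong_add Suc.IH cong_refl)
  finally show ?case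
    by (simp add: algebra_simps)
qed

text \<open>The digits below position \<open>k\<close> amount to less than one unit
  \<open>p ^ k\<close>, so adding the digit \<open>a k\<close> keeps the sum below
  \<open>(a k + 1) * p ^ k\<close>, and \<open>a k + 1\<close> is at most \<open>p\<close>.\<close>

lemma sum_digits_less_power:
  fixes p k :: nat and a :: "nat \<Rightarrow> nat"
  assumes "\<And>i. i < k \<Longrightarrow> a i < p"
  shows "(\<Sum>i=0..<k. a i * p ^ i) < p ^ k"
  using assms
proof (induction k)
  case 0
  then show ?case by simp
next
  case (Suc k)
  have "(\<Sum>i=0..<Suc k. a i * p ^ i) < p ^ k + a k * p ^ k"
    using Suc by simp
  also have "\<dots> = Suc (a k) * p ^ k"
    by simp
  also have "\<dots> \<le> p * p ^ k"
    using Suc.prems[of k] by (intro mult_right_mono) auto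
  finally show ?case by simp
qed

theorem theorem3p1:
  fixes p n k l A B :: nat and a :: "nat \<Rightarrow> nat"
  assumes "prime p"
    and "n = (\<Sum>i=0..l. a i * p ^ i)"
    and "\<forall>i\<le>l. 0 \<le> a i \<and> a i \<le> p - 1"
    and "1 \<le> k" and "k \<le> l"
    and "A = (\<Sum>i=k..l. a i * p ^ (i - k))"
    and "B = (\<Sum>i=0..<k. a i * p ^ i)"
  shows "n = A * p ^ k + B \<and> 0 \<le> B \<and> B \<le> p ^ k - 1 \<and>
    [int ((A * p ^ k + B) choose (p ^ k))
       - \<lfloor>real (A * p ^ k + B) / real (p ^ k)\<rfloor> = 0] (mod int p)"
proof -
  have "0 < p"
    using assms(1) by (rule prime_gt_0_nat)
  \<comment> \<open>Subtraction on naturals truncates, so the strict bound follows from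
    \<open>a i \<le> p - 1\<close> only because \<open>p\<close> is positive.\<close>
  have "a i < p" if "i < k" for i
    using assms(3)[rule_format, of i] that assms(5) \<open>0 < p\<close> by simp
  then have B: "B < p ^ k"
    unfolding assms(7) by (rule sum_digits_less_power)
  \<comment> \<open>Every index in the range satisfies \<open>k \<le> i\<close>, so
    \<open>i - k\<close> is a true difference and the exponents add up to \<open>i\<close>.\<close>
  have "A * p ^ k = (\<Sum>i=k..l. a i * p ^ i)"
    unfolding assms(6) sum_distrib_right
    by (intro sum.cong) (simp_all add: mult.assoc flip: power_add)
  moreover have "{0..l} = {0..<k} \<union> {k..l}"
    using assms(5) by auto
  then have "n = B + (\<Sum>i=k..l. a i * p ^ i)"
    unfolding assms(2,7) by (simp add: sum.union_disjoint ivl_disj_int)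
  ultimately have n: "n = A * p ^ k + B"
    by simp
  \<comment> \<open>The floor of the real quotient is integer division, whose quotient is exactly
    \<open>A\<close> since the remainder \<open>B\<close> is below \<open>p ^ k\<close>.\<close>
  have "\<lfloor>real (A * p ^ k + B) / real (p ^ k)\<rfloor> = int ((A * p ^ k + B) div p ^ k)"
    by (rule floor_divide_of_nat_eq)
  also have "(A * p ^ k + B) div p ^ k = A"
    using B \<open>0 < p\<close> by (simp add: div_mult_self3)
  finally have "\<lfloor>real (A * p ^ k + B) / real (p ^ k)\<rfloor> = int A" .
  moreover have "[int ((A * p ^ k + B) choose (p ^ k)) = int A] (mod int p)"
    using choose_prime_power_cong[OF assms(1) B] by (simp only: cong_int_iff)
  ultimately show ?thesis
    using n B by (simp only: cong_diff_iff_cong_0) simp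
qed

end
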